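(* Let $L$ be a locally compact Hausdorff space that is locally connected at some point $x\in L$. Let $X$ be a non-trivial (i.e. $X\neq\{0\}$) strictly convex real Banach space. Then: (i) If $C_0(L,X)$ is almost transitive, then $L$ is a singleton. (ii) If $C_0(L,X)$ is convex-transitive, then $L$ is connected.
   Context: All Banach spaces are real. For a Banach space $E$, let $\mathbf{B}_E$ be its closed unit ball, $\mathbf{S}_E$ its unit sphere, and $\mathcal{G}_E$ the group of isometric automorphisms (surjective linear isometries) $T\colon E\to E$; for $x\in E$ write $\mathcal{G}_E(x)=\{T(x): T\in\mathcal{G}_E\}$. The space $E$ is called almost transitive if $\overline{\mathcal{G}_E(x)}=\mathbf{S}_E$ for every $x\in\mathbf{S}_E$, and convex-transitive if $\overline{\mathrm{conv}}(\mathcal{G}_E(x))=\mathbf{B}_E$ for every $x\in\mathbf{S}_E$ (closures in norm). $C_0(L,X)$ is the Banach space of continuous functions $f\colon L\to X$ tending to $0$ at infinity, with norm $\|f\|=\sup_{t\in L}\|f(t)\|_X$. "Locally connected at $x$" means that every open neighbourhood of $x$ contains a connected open neighbourhood of $x$. *)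

theory Defs
  imports "HOL-Analysis.Analysis"
begin

text \<open>
  In the definitions below a real Banach space is given by a closed linear subspace \<open>E\<close> (possibly
  \<open>UNIV\<close>) of a normed type, so that they apply to \<open>C\<^sub>0(L,X)\<close> as a subspace of the type of bounded
  continuous functions. As \<open>E\<close> is closed, closures relative to \<open>E\<close> and in the type agree.
\<close>

definition strictly_convex_space :: "'e::real_normed_vector set \<Rightarrow> bool" where
  "strictly_convex_space E \<longleftrightarrow>
     (\<forall>u \<in> E \<inter> sphere 0 1. \<forall>v \<in> E \<inter> sphere 0 1. u \<noteq> v \<longrightarrow> norm (midpoint u v) < 1)"

text \<open>
  The values of \<open>T\<close> outside \<open>E\<close> are unconstrained; they do not enter the orbit of a point of \<open>E\<close>.
\<close>

definition isometric_automorphisms :: "'e::real_normed_vector set \<Rightarrow> ('e \<Rightarrow> 'e) set" where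
  "isometric_automorphisms E =
     {T. (\<forall>u\<in>E. \<forall>v\<in>E. T (u + v) = T u + T v) \<and>
         (\<forall>c. \<forall>u\<in>E. T (c *\<^sub>R u) = c *\<^sub>R T u) \<and>
         (\<forall>u\<in>E. norm (T u) = norm u) \<and>
         T ` E = E}"

definition isometry_orbit :: "'e::real_normed_vector set \<Rightarrow> 'e \<Rightarrow> 'e set" where
  "isometry_orbit E u = {T u | T. T \<in> isometric_automorphisms E}"

definition almost_transitive :: "'e::real_normed_vector set \<Rightarrow> bool" where
  "almost_transitive E \<longleftrightarrow>
     (\<forall>u \<in> E \<inter> sphere 0 1. closure (isometry_orbit E u) = E \<inter> sphere 0 1)"

definition convex_transitive :: "'e::real_normed_vector set \<Rightarrow> bool" where
  "convex_transitive E \<longleftrightarrow>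
     (\<forall>u \<in> E \<inter> sphere 0 1. closure (convex hull (isometry_orbit E u)) = E \<inter> cball 0 1)"

definition vanishes_at_infinity :: "('l::topological_space \<Rightarrow> 'x::real_normed_vector) \<Rightarrow> bool" where
  "vanishes_at_infinity f \<longleftrightarrow> (\<forall>e>0. \<exists>K. compact K \<and> (\<forall>t. t \<notin> K \<longrightarrow> norm (f t) < e))"

text \<open>
  The norm is the one of the type of bounded continuous functions, i.e. the supremum norm.
  Boundedness is no restriction, by \<open>continuous_vanishing_in_bcontfun\<close> below.
\<close>

definition C0 :: "('l::topological_space \<Rightarrow>\<^sub>C 'x::real_normed_vector) set" where
  "C0 = {f. vanishes_at_infinity (apply_bcontfun f)}"

lemma continuous_vanishing_in_bcontfun:
  fixes f :: "'l::topological_space \<Rightarrow> 'x::real_normed_vector"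
  assumes "continuous_on UNIV f" and "vanishes_at_infinity f"
  shows "f \<in> bcontfun"
proof -
  obtain K where K: "compact K" "\<And>t. t \<notin> K \<Longrightarrow> norm (f t) < 1"
    using assms(2) unfolding vanishes_at_infinity_def by (metis zero_less_one)
  have "compact (f ` K)"
    using K(1) assms(1) by (meson compact_continuous_image continuous_on_subset subset_UNIV)
  then obtain B where B: "\<And>t. t \<in> K \<Longrightarrow> norm (f t) \<le> B"
    by (metis bounded_iff compact_imp_bounded imageI)
  have "norm (f t) \<le> max B 1" for t
    using B[of t] K(2)[of t] by (cases "t \<in> K") auto
  then have "bounded (range f)"
    by (auto simp: bounded_iff)
  then show ?thesis
    using assms(1) by (simp add: bcontfun_def)
qed

lemma subspace_C0: "subspace (C0 :: ('l::topological_space \<Rightarrow>\<^sub>C 'x::real_normed_vector) set)"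
proof (rule subspaceI)
  show "(0 :: 'l \<Rightarrow>\<^sub>C 'x) \<in> C0"
    by (auto simp: C0_def vanishes_at_infinity_def)
next
  fix f g :: "'l \<Rightarrow>\<^sub>C 'x"
  assume fg: "f \<in> C0" "g \<in> C0"
  have "\<exists>K. compact K \<and> (\<forall>t. t \<notin> K \<longrightarrow> norm (apply_bcontfun (f + g) t) < e)" if "e > 0" for e
  proof -
    have "e / 2 > 0"
      using that by simp
    then obtain K K' where K: "compact K" "\<And>t. t \<notin> K \<Longrightarrow> norm (apply_bcontfun f t) < e / 2"
      and K': "compact K'" "\<And>t. t \<notin> K' \<Longrightarrow> norm (apply_bcontfun g t) < e / 2"
      using fg unfolding C0_def vanishes_at_infinity_def mem_Collect_eq by meson
    have "norm (apply_bcontfun (f + g) t) < e" if "t \<notin> K \<union> K'" for t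
      using K(2)[of t] K'(2)[of t] that norm_triangle_lt[of "f t" "g t" e] by auto
    then show ?thesis
      using K(1) K'(1) by (metis compact_Un)
  qed
  then show "f + g \<in> C0"
    by (simp add: C0_def vanishes_at_infinity_def)
next
  fix c :: real and f :: "'l \<Rightarrow>\<^sub>C 'x"
  assume f: "f \<in> C0"
  have "\<exists>K. compact K \<and> (\<forall>t. t \<notin> K \<longrightarrow> norm (apply_bcontfun (c *\<^sub>R f) t) < e)" if "e > 0" for e
  proof -
    have "e / (\<bar>c\<bar> + 1) > 0"
      using that by simp
    then obtain K where K: "compact K" "\<And>t. t \<notin> K \<Longrightarrow> norm (apply_bcontfun f t) < e / (\<bar>c\<bar> + 1)"
      using f unfolding C0_def vanishes_at_infinity_def mem_Collect_eq by meson
    have "norm (apply_bcontfun (c *\<^sub>R f) t) < e" if "t \<notin> K" for t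
    proof -
      have "(\<bar>c\<bar> + 1) * norm (f t) < e"
        using K(2)[OF that] by (simp add: field_simps)
      moreover have "\<bar>c\<bar> * norm (f t) \<le> (\<bar>c\<bar> + 1) * norm (f t)"
        by (intro mult_right_mono) auto
      ultimately show ?thesis
        by simp
    qed
    then show ?thesis
      using K(1) by blast
  qed
  then show "c *\<^sub>R f \<in> C0"
    by (simp add: C0_def vanishes_at_infinity_def)
qed

lemma closed_C0: "closed (C0 :: ('l::topological_space \<Rightarrow>\<^sub>C 'x::real_normed_vector) set)"
proof -
  have "f \<in> C0" if f: "f \<in> closure C0" for f :: "'l \<Rightarrow>\<^sub>C 'x"
  proof -
    have "\<exists>K. compact K \<and> (\<forall>t. t \<notin> K \<longrightarrow> norm (apply_bcontfun f t) < e)" if "e > 0" for e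
    proof -
      have e: "e / 2 > 0"
        using that by simp
      then obtain g where g: "g \<in> C0" "dist g f < e / 2"
        using f by (meson closure_approachable)
      then obtain K where K: "compact K" "\<And>t. t \<notin> K \<Longrightarrow> norm (apply_bcontfun g t) < e / 2"
        using e unfolding C0_def vanishes_at_infinity_def mem_Collect_eq by meson
      have "norm (f t) < e" if "t \<notin> K" for t
      proof -
        have "dist (g t) (f t) < e / 2"
          using g(2) dist_bounded[of g t f] by linarith
        then have "norm (f t - g t) < e / 2"
          by (simp add: dist_norm norm_minus_commute)
        then show ?thesis
          using K(2)[OF that] norm_triangle_sub[of "f t" "g t"] by linarith
      qed
      then show ?thesis
        using K(1) by blast
    qed
    then show ?thesis
      by (simp add: C0_def vanishes_at_infinity_def)
  qed
  then show ?thesis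
    by (simp add: closure_subset_eq[symmetric] subsetI)
qed

end

theory Submission
  imports Defs
begin

text \<open>
  The argument has two halves. The first is a Banach--Stone theorem for strictly convex \<open>X\<close>: every
  isometric automorphism \<open>T\<close> of \<open>C\<^sub>0(L,X)\<close> comes with a continuous surjection \<open>\<psi>\<close> of \<open>L\<close> such that
  \<open>\<parallel>T f (\<psi> s)\<parallel> = \<parallel>f s\<parallel>\<close> for all \<open>f\<close> and \<open>s\<close> (\<open>automorphism_moves_points\<close>). To find \<open>\<psi>\<close>, consider the
  sets \<open>face s y\<close> of all norm-one functions with the value \<open>y\<close> at \<open>s\<close>, where \<open>\<parallel>y\<parallel> = 1\<close>. By strict
  convexity and compactness they are exactly the maximal convex subsets of the unit sphere, so \<open>T\<close>
  permutes them. Two such faces are disjoint if they belong to the same point but to different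
  values, and they meet if they belong to different points. As disjointness is preserved, the point
  of the image face depends on \<open>s\<close> alone and defines \<open>\<psi> s\<close>. Finally \<open>\<parallel>f s\<parallel>\<close> can be read off from the
  norms \<open>\<parallel>f + N g\<parallel>\<close>, where \<open>N \<ge> \<parallel>f\<parallel>\<close> and \<open>g\<close> runs through the faces at \<open>s\<close>, and \<open>T\<close> preserves these.

  The second half exploits one norm-one function \<open>h\<close> whose peak is connected
  (\<open>exists_connected_peak\<close>). Local connectedness at \<open>x\<close> yields a connected neighbourhood \<open>W\<close> of \<open>x\<close>
  and an \<open>h\<close> with \<open>{\<parallel>h\<parallel> > 1/2} \<subseteq> W \<subseteq> {\<parallel>h\<parallel> > 1/4}\<close>. Each \<open>T h\<close> inherits this property with \<open>\<psi> ` W\<close> in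
  place of \<open>W\<close>.

  If the space is almost transitive and \<open>a \<noteq> x\<close>, some \<open>T h\<close> approximates a function that has the
  value \<open>y\<close> at \<open>a\<close> and \<open>x\<close> and vanishes outside the union of disjoint open neighbourhoods of them.
  The connected set \<open>\<psi> ` W\<close> then contains both points and lies in this union, which is impossible. If the
  space is convex-transitive and \<open>L\<close> is the union of disjoint open sets containing \<open>a\<close> and \<open>b\<close>
  respectively, approximate a norm-one function with \<open>f a = f b = y\<close> by convex combinations of images
  of \<open>h\<close>. One of these images has norm above \<open>1/2\<close> at both \<open>a\<close> and \<open>b\<close>, and its connected peak
  joins the two parts of \<open>L\<close>.
\<close>

section \<open>Bump functions\<close>

text \<open>
  Urysohn functions exist because locally compact Hausdorff spaces are completely regular. Cutting
  off inside a compact neighbourhood of \<open>s\<close> makes them vanish at infinity. The scalar factor \<open>p\<close> is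
  kept in the statement since all later estimates are made with it.
\<close>

lemma bump_in_C0:
  fixes s :: "'l::t2_space" and y :: "'x::real_normed_vector"
  assumes "locally_compact_space (euclidean :: 'l topology)" and "open U" and "s \<in> U"
  obtains f :: "'l \<Rightarrow>\<^sub>C 'x" and p :: "'l \<Rightarrow> real"
    where "f \<in> C0" "\<And>t. f t = p t *\<^sub>R y" "\<And>t. 0 \<le> p t" "\<And>t. p t \<le> 1" "p s = 1"
      "\<And>t. t \<notin> U \<Longrightarrow> p t = 0"
proof -
  have haus: "Hausdorff_space (euclidean :: 'l topology)"
    using hausdorff by (fastforce simp: Hausdorff_space_def disjnt_def)
  have creg: "completely_regular_space (euclidean :: 'l topology)"
    using locally_compact_regular_imp_completely_regular_space[OF assms(1)] haus by blast
  obtain V K where VK: "open V" "compact K" "s \<in> V" "V \<subseteq> K"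
    using assms(1) unfolding locally_compact_space_def by simp metis
  have "closedin euclidean (- (U \<inter> V))"
    using assms(2) VK(1) by (metis closed_Compl closed_closedin open_Int)
  then obtain q :: "'l \<Rightarrow> real" where q: "continuous_map euclidean (top_of_set {0..1}) q"
      "q s = 0" "q ` (- (U \<inter> V)) \<subseteq> {1}"
    using creg assms(3) VK(3) unfolding completely_regular_space_def
    by (metis ComplD Diff_iff IntI UNIV_I topspace_euclidean)
  have qc: "continuous_on UNIV q" and q01: "\<And>t. 0 \<le> q t \<and> q t \<le> 1"
    using q(1) by (auto simp: continuous_map_in_subtopology image_subset_iff)
  define g where "g t = (1 - q t) *\<^sub>R y" for t
  have "vanishes_at_infinity g"
    unfolding vanishes_at_infinity_def
  proof (intro allI impI exI conjI)
    show "compact K"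
      by (rule VK(2))
    fix e :: real and t
    assume "0 < e" "t \<notin> K"
    then have "q t = 1"
      using q(3) VK(4) by blast
    then show "norm (g t) < e"
      using \<open>0 < e\<close> by (simp add: g_def)
  qed
  moreover have "continuous_on UNIV g"
    unfolding g_def by (intro continuous_intros qc)
  ultimately have "g \<in> bcontfun"
    by (rule continuous_vanishing_in_bcontfun[rotated])
  then obtain f :: "'l \<Rightarrow>\<^sub>C 'x" where f: "g = apply_bcontfun f"
    by (rule bcontfunE)
  show ?thesis
  proof (rule that[of f "\<lambda>t. 1 - q t"])
    show "f \<in> C0"
      using \<open>vanishes_at_infinity g\<close> by (simp add: C0_def f)
    show "f t = (1 - q t) *\<^sub>R y" for t
      using fun_cong[OF f, of t] by (simp add: g_def)
    show "1 - q t = 0" if "t \<notin> U" for t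
      using q(3) that by auto
  qed (use q01 q(2) in auto)
qed

lemma two_bumps_in_C0:
  fixes s t :: "'l::t2_space" and y z :: "'x::real_normed_vector"
  assumes lc: "locally_compact_space (euclidean :: 'l topology)"
    and "open U" "open V" "s \<in> U" "t \<in> V" "U \<inter> V = {}" "norm y = 1" "norm z = 1"
  obtains f :: "'l \<Rightarrow>\<^sub>C 'x"
    where "f \<in> C0" "norm f = 1" "f s = y" "f t = z" "\<And>r. f r \<noteq> 0 \<Longrightarrow> r \<in> U \<union> V"
proof -
  obtain f :: "'l \<Rightarrow>\<^sub>C 'x" and p where
    f: "f \<in> C0" "\<And>t. f t = p t *\<^sub>R y" "\<And>t. 0 \<le> p t" "\<And>t. p t \<le> 1" "p s = 1"
      "\<And>t. t \<notin> U \<Longrightarrow> p t = 0"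
    using bump_in_C0[OF lc assms(2,4)] by blast
  obtain g :: "'l \<Rightarrow>\<^sub>C 'x" and q where
    g: "g \<in> C0" "\<And>t. g t = q t *\<^sub>R z" "\<And>t. 0 \<le> q t" "\<And>t. q t \<le> 1" "q t = 1"
      "\<And>t. t \<notin> V \<Longrightarrow> q t = 0"
    using bump_in_C0[OF lc assms(3,5)] by blast
  have "s \<notin> V" "t \<notin> U"
    using assms(4-6) by blast+
  then have at_s: "(f + g) s = y" and at_t: "(f + g) t = z"
    using f(2,5) f(6)[of t] g(2,5) g(6)[of s] by simp_all
  have "norm ((f + g) r) \<le> 1" for r
  proof (cases "r \<in> U")
    case True
    then have "r \<notin> V"
      using assms(6) by blast
    then show ?thesis
      using f(2-4)[of r] g(2,6)[of r] assms(7) by simp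
  next
    case False
    then show ?thesis
      using f(2,6)[of r] g(2-4)[of r] assms(8) by simp
  qed
  then have "norm (f + g) \<le> 1"
    by (rule norm_bound)
  moreover have "1 \<le> norm (f + g)"
    using norm_bounded[of "f + g" s] unfolding at_s using assms(7) by simp
  ultimately have "norm (f + g) = 1"
    by simp
  moreover have "r \<in> U \<union> V" if "(f + g) r \<noteq> 0" for r
    using that f(2,6)[of r] g(2,6)[of r] by (cases "r \<in> U"; cases "r \<in> V") simp_all
  ultimately show ?thesis
    using that[of "f + g"] subspace_add[OF subspace_C0 f(1) g(1)] at_s at_t by metis
qed

section \<open>Faces of the unit sphere\<close>

text \<open>
  For \<open>\<parallel>y\<parallel> = 1\<close> and \<open>X\<close> strictly convex these are the maximal convex subsets of the unit sphere
  of \<open>C\<^sub>0(L,X)\<close>.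
\<close>

definition face :: "'l::topological_space \<Rightarrow> 'x::real_normed_vector \<Rightarrow> ('l \<Rightarrow>\<^sub>C 'x) set" where
  "face s y = {f \<in> C0. norm f = 1 \<and> f s = y}"

lemma convex_face:
  assumes "norm y = 1"
  shows "convex (face s y)"
proof (rule convexI)
  fix f g and u v :: real
  assume f: "f \<in> face s y" and g: "g \<in> face s y" and uv: "0 \<le> u" "0 \<le> v" "u + v = 1"
  have at_s: "(u *\<^sub>R f + v *\<^sub>R g) s = y"
    using f g uv by (simp add: face_def scaleR_left_distrib[symmetric])
  have "norm (u *\<^sub>R f + v *\<^sub>R g) \<le> u + v"
    using norm_triangle_ineq[of "u *\<^sub>R f" "v *\<^sub>R g"] f g uv by (simp add: face_def)
  moreover have "1 \<le> norm (u *\<^sub>R f + v *\<^sub>R g)"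
    using norm_bounded[of "u *\<^sub>R f + v *\<^sub>R g" s] unfolding at_s using assms by simp
  ultimately show "u *\<^sub>R f + v *\<^sub>R g \<in> face s y"
    using f g uv at_s
    by (auto simp: face_def intro!: subspace_add[OF subspace_C0] subspace_mul[OF subspace_C0])
qed

lemma face_nonempty:
  fixes s :: "'l::t2_space"
  assumes "locally_compact_space (euclidean :: 'l topology)" and "norm y = 1"
  shows "face s y \<noteq> {}"
proof -
  obtain f :: "'l \<Rightarrow>\<^sub>C 'a" and p where
    f: "f \<in> C0" "\<And>t. f t = p t *\<^sub>R y" "\<And>t. 0 \<le> p t" "\<And>t. p t \<le> 1" "p s = 1"
    using bump_in_C0[OF assms(1) open_UNIV UNIV_I] by metis
  have "norm f \<le> 1"
    using f(2-4) assms(2) by (intro norm_bound) simp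
  moreover have "1 \<le> norm f"
    using norm_bounded[of f s] f(2,5) assms(2) by simp
  ultimately show ?thesis
    using f by (auto simp: face_def)
qed

text \<open>
  The value at a second point can be prescribed as any unit vector, in particular as \<open>- z\<close>, which
  differs from \<open>z\<close>. Hence no face is contained in another one, which is what makes all of them maximal.
\<close>

lemma face_subset_face:
  fixes s :: "'l::t2_space"
  assumes lc: "locally_compact_space (euclidean :: 'l topology)"
    and y: "norm y = 1" "norm z = 1" and sub: "face s y \<subseteq> face t z"
  shows "s = t \<and> y = z"
proof -
  have "s = t"
  proof (rule ccontr)
    assume "s \<noteq> t"
    then obtain U V where "open U" "open V" "s \<in> U" "t \<in> V" "U \<inter> V = {}"
      by (meson hausdorff)
    moreover have "norm (- z) = 1"
      using y by simp
    ultimately obtain f :: "'l \<Rightarrow>\<^sub>C 'a" where "f \<in> C0" "norm f = 1" "f s = y" "f t = - z"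
      using two_bumps_in_C0[OF lc] y(1) by metis
    then have "z = - z"
      using sub by (auto simp: face_def)
    then show False
      using y(2) by (metis add.right_inverse norm_zero scaleR_half_double scaleR_zero_right zero_neq_one)
  qed
  then show ?thesis
    using face_nonempty[OF lc y(1), of s] sub by (auto simp: face_def)
qed

lemma C0_small_outside_compact:
  assumes "f \<in> C0" "e > 0"
  obtains K where "compact K" "\<And>t. t \<notin> K \<Longrightarrow> norm (f t) < e"
proof -
  have "\<exists>K. compact K \<and> (\<forall>t. t \<notin> K \<longrightarrow> norm (f t) < e)"
    using assms by (simp add: C0_def vanishes_at_infinity_def)
  then show ?thesis
    using that by blast
qed

lemma C0_norm_attained:
  fixes f :: "'l::topological_space \<Rightarrow>\<^sub>C 'x::real_normed_vector"
  assumes "f \<in> C0" "norm f = 1"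
  obtains t where "norm (f t) = 1"
proof -
  obtain K where K: "compact K" "\<And>t. t \<notin> K \<Longrightarrow> norm (f t) < 1 / 2"
    using C0_small_outside_compact[OF assms(1), of "1/2"] by auto
  have "K \<noteq> {}"
  proof
    assume "K = {}"
    then have "norm (f t) \<le> 1 / 2" for t
      using K(2)[of t] by simp
    then have "norm f \<le> 1 / 2"
      by (rule norm_bound)
    then show False
      using assms(2) by simp
  qed
  then obtain t where t: "t \<in> K" "\<And>r. r \<in> K \<Longrightarrow> norm (f r) \<le> norm (f t)"
    using continuous_attains_sup[OF K(1), of "\<lambda>t. norm (f t)"]
    by (metis continuous_on_apply_bcontfun continuous_on_norm)
  have "norm (f r) \<le> max (1 / 2) (norm (f t))" for r
    using K(2)[of r] t(2)[of r] by (cases "r \<in> K") auto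
  then have "norm f \<le> max (1 / 2) (norm (f t))"
    by (rule norm_bound)
  moreover have "norm (f t) \<le> 1"
    using norm_bounded[of f t] assms(2) by simp
  ultimately show ?thesis
    using that[of t] assms(2) by linarith
qed

lemma midpoint_norm_one_imp_eq:
  fixes u v :: "'x::real_normed_vector"
  assumes "strictly_convex_space (UNIV :: 'x set)"
    and "norm u \<le> 1" "norm v \<le> 1" "norm (midpoint u v) = 1"
  shows "u = v"
proof -
  have "norm (u + v) = 2"
    using assms(4) by (simp add: midpoint_def)
  then have "norm u = 1" "norm v = 1"
    using norm_triangle_ineq[of u v] assms(2,3) by linarith+
  then show ?thesis
    using assms(1,4) unfolding strictly_convex_space_def by force
qed

text \<open>
  Iterated midpoints of the members of \<open>G\<close>: where a midpoint has norm one, strict convexity forces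
  the two functions to agree.
\<close>

lemma finite_common_value:
  fixes F :: "('l::topological_space \<Rightarrow>\<^sub>C 'x::real_normed_vector) set"
  assumes sc: "strictly_convex_space (UNIV :: 'x set)"
    and "convex F" "F \<noteq> {}" and nF: "\<And>f. f \<in> F \<Longrightarrow> norm f = 1"
    and "finite G" "G \<subseteq> F"
  shows "\<exists>g\<in>F. \<forall>t. norm (g t) = 1 \<longrightarrow> (\<forall>f\<in>G. f t = g t)"
  using assms(5,6)
proof (induction G)
  case empty
  then show ?case
    using assms(3) by blast
next
  case (insert f G)
  then obtain g where g: "g \<in> F" "\<And>t f. norm (g t) = 1 \<Longrightarrow> f \<in> G \<Longrightarrow> f t = g t"
    by blast
  have fF: "f \<in> F"
    using insert by blast
  have "midpoint f g \<in> F"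
    using \<open>convex F\<close> fF g(1) by (metis closed_segment_subset midpoint_in_closed_segment subsetD)
  moreover have "h t = midpoint f g t" if t: "norm (midpoint f g t) = 1" and h: "h \<in> insert f G" for t h
  proof -
    have mid: "midpoint f g t = midpoint (f t) (g t)"
      by (simp add: midpoint_def)
    have "norm (f t) \<le> 1" "norm (g t) \<le> 1"
      using norm_bounded[of f t] norm_bounded[of g t] nF fF g(1) by auto
    then have "f t = g t"
      using midpoint_norm_one_imp_eq[OF sc] t unfolding mid by blast
    then show ?thesis
      using g(2)[of t h] h t unfolding mid by auto
  qed
  ultimately show ?case
    by blast
qed

text \<open>
  By \<open>finite_common_value\<close> any finitely many members of \<open>F\<close> agree, with a common unit value, at some
  point. These sets of agreement with a fixed \<open>f0\<close> are closed and lie in a compact set off which \<open>f0\<close>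
  has norm below one, so by the finite intersection property one point serves all of \<open>F\<close>.
\<close>

lemma convex_subset_sphere_in_face:
  fixes F :: "('l::t2_space \<Rightarrow>\<^sub>C 'x::real_normed_vector) set"
  assumes sc: "strictly_convex_space (UNIV :: 'x set)"
    and "convex F" "F \<noteq> {}" and nF: "\<And>f. f \<in> F \<Longrightarrow> norm f = 1" and "F \<subseteq> C0"
  shows "\<exists>t z. norm z = 1 \<and> F \<subseteq> face t z"
proof -
  obtain f0 where f0: "f0 \<in> F"
    using assms(3) by blast
  then obtain K where K: "compact K" "\<And>t. t \<notin> K \<Longrightarrow> norm (f0 t) < 1"
    using C0_small_outside_compact[of f0 1] \<open>F \<subseteq> C0\<close> by auto
  define P where "P f = {t. f t = f0 t} \<inter> {t. norm (f0 t) = 1}" for f :: "'l \<Rightarrow>\<^sub>C 'x"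
  have "K \<inter> (\<Inter>f\<in>F. P f) \<noteq> {}"
  proof (rule compact_imp_fip_image[OF K(1)])
    show "closed (P f)" for f
      unfolding P_def by (intro closed_Int closed_Collect_eq continuous_intros) auto
    fix G
    assume G: "finite G" "G \<subseteq> F"
    then obtain g where g: "g \<in> F" "\<And>t f. norm (g t) = 1 \<Longrightarrow> f \<in> insert f0 G \<Longrightarrow> f t = g t"
      using finite_common_value[OF sc assms(2,3) nF, of "insert f0 G"] f0 by (metis finite_insert insert_subset)
    then obtain t where t: "norm (g t) = 1"
      using C0_norm_attained[of g] nF \<open>F \<subseteq> C0\<close> by blast
    have "f0 t = g t"
      using g(2)[OF t] by blast
    moreover have "f t = f0 t" if "f \<in> G" for f
      using g(2)[OF t] that \<open>f0 t = g t\<close> by auto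
    ultimately have "t \<in> K" "\<forall>f\<in>G. t \<in> P f"
      using t K(2)[of t] by (auto simp: P_def)
    then show "K \<inter> (\<Inter>f\<in>G. P f) \<noteq> {}"
      by blast
  qed
  then obtain t where t: "\<And>f. f \<in> F \<Longrightarrow> t \<in> P f"
    by blast
  have "norm (f0 t) = 1"
    using t[OF f0] by (simp add: P_def)
  moreover have "f \<in> face t (f0 t)" if "f \<in> F" for f
    using t[OF that] nF[OF that] \<open>F \<subseteq> C0\<close> that by (auto simp: P_def face_def)
  ultimately show ?thesis
    by blast
qed

section \<open>Isometric automorphisms\<close>

lemma isometric_automorphismD:
  assumes "T \<in> isometric_automorphisms E"
  shows "\<And>u v. u \<in> E \<Longrightarrow> v \<in> E \<Longrightarrow> T (u + v) = T u + T v"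
    and "\<And>c u. u \<in> E \<Longrightarrow> T (c *\<^sub>R u) = c *\<^sub>R T u"
    and "\<And>u. u \<in> E \<Longrightarrow> norm (T u) = norm u"
    and "T ` E = E"
  using assms unfolding isometric_automorphisms_def by blast+

lemma isometric_automorphism_inverse:
  fixes E :: "'e::real_normed_vector set"
  assumes E: "subspace E" and T: "T \<in> isometric_automorphisms E"
  obtains S where "S \<in> isometric_automorphisms E"
    "\<And>u. u \<in> E \<Longrightarrow> S (T u) = u" "\<And>u. u \<in> E \<Longrightarrow> T (S u) = u"
proof -
  note T' = isometric_automorphismD[OF T]
  have inj: "inj_on T E"
  proof (rule inj_onI)
    fix u v
    assume uv: "u \<in> E" "v \<in> E" "T u = T v"
    have "T (u + (-1) *\<^sub>R v) = T u + (-1) *\<^sub>R T v"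
      using T'(1,2) uv E by (metis subspace_mul)
    then have "norm (u + (-1) *\<^sub>R v) = 0"
      using T'(3)[of "u + (-1) *\<^sub>R v"] uv E by (simp add: subspace_diff)
    then show "u = v"
      by simp
  qed
  define S where "S = inv_into E T"
  have ST: "S (T u) = u" if "u \<in> E" for u
    using inj that by (simp add: S_def)
  have TS: "T (S u) = u" if "u \<in> E" for u
    using T'(4) that by (simp add: S_def f_inv_into_f)
  have SE: "S u \<in> E" if "u \<in> E" for u
    using T'(4) that unfolding S_def by (metis inv_into_into)
  have "S (u + v) = S u + S v" if "u \<in> E" "v \<in> E" for u v
    using T'(1)[of "S u" "S v"] that ST[of "S u + S v"] TS SE E by (simp add: subspace_add)
  moreover have "S (c *\<^sub>R u) = c *\<^sub>R S u" if "u \<in> E" for c u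
    using T'(2)[of "S u" c] that ST[of "c *\<^sub>R S u"] TS SE E by (simp add: subspace_mul)
  moreover have "norm (S u) = norm u" if "u \<in> E" for u
    using T'(3)[of "S u"] TS SE that by simp
  moreover have "S ` E = E"
  proof
    show "E \<subseteq> S ` E"
      using ST T'(4) by (metis image_eqI image_subset_iff order_refl subsetI)
  qed (use SE in blast)
  ultimately have "S \<in> isometric_automorphisms E"
    unfolding isometric_automorphisms_def by blast
  then show ?thesis
    using that ST TS by blast
qed

lemma automorphism_image_in_face:
  fixes T :: "('l::t2_space \<Rightarrow>\<^sub>C 'x::real_normed_vector) \<Rightarrow> ('l \<Rightarrow>\<^sub>C 'x)"
  assumes lc: "locally_compact_space (euclidean :: 'l topology)"
    and sc: "strictly_convex_space (UNIV :: 'x set)"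
    and T: "T \<in> isometric_automorphisms C0" and y: "norm y = 1"
  shows "\<exists>t z. norm z = 1 \<and> T ` face s y \<subseteq> face t z"
proof (rule convex_subset_sphere_in_face[OF sc])
  note T' = isometric_automorphismD[OF T]
  have C0: "face s y \<subseteq> C0"
    by (auto simp: face_def)
  show "T ` face s y \<subseteq> C0"
    using C0 T'(4) by blast
  show "T ` face s y \<noteq> {}"
    using face_nonempty[OF lc y] by blast
  show "norm f = 1" if "f \<in> T ` face s y" for f
    using that T'(3) by (auto simp: face_def)
  show "convex (T ` face s y)"
  proof (rule convexI; clarify)
    fix f g and u v :: real
    assume fg: "f \<in> face s y" "g \<in> face s y" and uv: "0 \<le> u" "0 \<le> v" "u + v = 1"
    have "f \<in> C0" "g \<in> C0"
      using fg C0 by auto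
    then have "u *\<^sub>R T f + v *\<^sub>R T g = T (u *\<^sub>R f + v *\<^sub>R g)"
      using T'(1,2) subspace_C0 by (metis subspace_mul)
    then show "u *\<^sub>R T f + v *\<^sub>R T g \<in> T ` face s y"
      using convexD[OF convex_face[OF y] fg uv] by auto
  qed
qed

text \<open>
  An automorphism maps a face into a face, and so does its inverse; going there and back leads from
  a face into a face, which by \<open>face_subset_face\<close> is the same one.
\<close>

lemma automorphism_face:
  fixes T :: "('l::t2_space \<Rightarrow>\<^sub>C 'x::real_normed_vector) \<Rightarrow> ('l \<Rightarrow>\<^sub>C 'x)"
  assumes lc: "locally_compact_space (euclidean :: 'l topology)"
    and sc: "strictly_convex_space (UNIV :: 'x set)"
    and T: "T \<in> isometric_automorphisms C0" and y: "norm y = 1"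
  shows "\<exists>t z. norm z = 1 \<and> T ` face s y = face t z"
proof -
  obtain S where S: "S \<in> isometric_automorphisms C0"
      and ST: "\<And>f. f \<in> C0 \<Longrightarrow> S (T f) = f" and TS: "\<And>f. f \<in> C0 \<Longrightarrow> T (S f) = f"
    using isometric_automorphism_inverse[OF subspace_C0 T] by metis
  have sub: "face r w \<subseteq> C0" for r and w :: 'x
    by (auto simp: face_def)
  obtain t z where t: "norm z = 1" "T ` face s y \<subseteq> face t z"
    using automorphism_image_in_face[OF lc sc T y] by blast
  obtain r w where r: "norm w = 1" "S ` face t z \<subseteq> face r w"
    using automorphism_image_in_face[OF lc sc S t(1)] by blast
  have "face s y \<subseteq> face r w"
  proof
    fix f
    assume f: "f \<in> face s y"
    then have "S (T f) \<in> face r w"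
      using t(2) r(2) by blast
    then show "f \<in> face r w"
      using ST[of f] sub f by (metis subsetD)
  qed
  then have "r = s" "w = y"
    using face_subset_face[OF lc y r(1)] by blast+
  have "face t z \<subseteq> T ` face s y"
  proof
    fix g
    assume g: "g \<in> face t z"
    then have "S g \<in> face s y"
      using r(2) \<open>r = s\<close> \<open>w = y\<close> by blast
    moreover have "T (S g) = g"
      using TS[of g] sub g by (metis subsetD)
    ultimately show "g \<in> T ` face s y"
      by (metis image_eqI)
  qed
  then show ?thesis
    using t by blast
qed

text \<open>
  The images of \<open>face s y\<close> and \<open>face s y'\<close> are disjoint if \<open>y \<noteq> y'\<close>. Faces at two different points
  share a function with two bumps, so the images are faces at the same point.
\<close>

lemma automorphism_base_point:
  fixes T :: "('l::t2_space \<Rightarrow>\<^sub>C 'x::real_normed_vector) \<Rightarrow> ('l \<Rightarrow>\<^sub>C 'x)"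
  assumes lc: "locally_compact_space (euclidean :: 'l topology)"
    and sc: "strictly_convex_space (UNIV :: 'x set)"
    and T: "T \<in> isometric_automorphisms C0"
  shows "\<exists>t. \<forall>y. norm y = 1 \<longrightarrow> (\<exists>z. norm z = 1 \<and> T ` face s y = face t z)"
proof (cases "\<exists>y::'x. norm y = 1")
  case True
  then obtain y :: 'x where y: "norm y = 1"
    by blast
  obtain t z where t: "norm z = 1" "T ` face s y = face t z"
    using automorphism_face[OF lc sc T y] by blast
  have "\<exists>w. norm w = 1 \<and> T ` face s y' = face t w" if y': "norm y' = 1" for y'
  proof (cases "y' = y")
    case False
    obtain t' z' where t': "norm z' = 1" "T ` face s y' = face t' z'"
      using automorphism_face[OF lc sc T y'] by blast
    have "t = t'"
    proof (rule ccontr)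
      assume "t \<noteq> t'"
      then obtain U V where "open U" "open V" "t \<in> U" "t' \<in> V" "U \<inter> V = {}"
        by (meson hausdorff)
      then obtain g :: "'l \<Rightarrow>\<^sub>C 'x" where "g \<in> C0" "norm g = 1" "g t = z" "g t' = z'"
        using two_bumps_in_C0[OF lc] t(1) t'(1) by metis
      then have "g \<in> T ` face s y" "g \<in> T ` face s y'"
        using t t' by (auto simp: face_def)
      then obtain f f' where f: "f \<in> face s y" "f' \<in> face s y'" "T f = g" "T f' = g"
        by (metis imageE)
      obtain S where "\<And>f. f \<in> C0 \<Longrightarrow> S (T f) = f"
        using isometric_automorphism_inverse[OF subspace_C0 T] by metis
      then have "f = f'"
        using f unfolding face_def by (metis (no_types, lifting) mem_Collect_eq)
      then show False
        using f(1,2) False by (auto simp: face_def)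
    qed
    then show ?thesis
      using t' by blast
  qed (use t in blast)
  then show ?thesis
    by blast
qed auto

text \<open>
  Let \<open>N \<ge> \<parallel>f\<parallel>\<close>. If \<open>g \<in> face s y\<close> is concentrated near \<open>s\<close>, then \<open>\<parallel>f + N g\<parallel>\<close> is at most slightly
  above \<open>N + \<parallel>f s\<parallel>\<close>: away from \<open>s\<close> only \<open>f\<close> contributes. On the other hand, if \<open>T g \<in> face t z\<close> for
  the direction \<open>z\<close> of \<open>T f t\<close>, then \<open>T f + N T g\<close> has norm \<open>N + \<parallel>T f t\<parallel>\<close> at \<open>t\<close>. As \<open>T\<close> is isometric,
  the two bounds compare.
\<close>

lemma automorphism_value_norm_le:
  fixes T :: "('l::t2_space \<Rightarrow>\<^sub>C 'x::real_normed_vector) \<Rightarrow> ('l \<Rightarrow>\<^sub>C 'x)"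
  assumes lc: "locally_compact_space (euclidean :: 'l topology)"
    and T: "T \<in> isometric_automorphisms C0"
    and faces: "\<And>z. norm z = 1 \<Longrightarrow> \<exists>y. norm y = 1 \<and> T ` face s y = face t z"
    and f: "f \<in> C0"
  shows "norm (T f t) \<le> norm (f s)"
proof (cases "T f t = 0")
  case False
  note T' = isometric_automorphismD[OF T]
  define w where "w = T f t"
  define z where "z = w /\<^sub>R norm w"
  define N where "N = norm f"
  have z: "norm z = 1" and wz: "w = norm w *\<^sub>R z"
    using False by (auto simp: z_def w_def)
  obtain y where y: "norm y = 1" "T ` face s y = face t z"
    using faces[OF z] by blast
  have "norm w \<le> norm (f s) + e" if "e > 0" for e
  proof -
    define U where "U = {r. norm (f r) < norm (f s) + e}"
    have "open U"
      unfolding U_def by (intro open_Collect_less continuous_intros) auto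
    moreover have "s \<in> U"
      using that by (simp add: U_def)
    ultimately obtain g :: "'l \<Rightarrow>\<^sub>C 'x" and p where
      g: "g \<in> C0" "\<And>t. g t = p t *\<^sub>R y" "\<And>t. 0 \<le> p t" "\<And>t. p t \<le> 1" "p s = 1"
        "\<And>t. t \<notin> U \<Longrightarrow> p t = 0"
      using bump_in_C0[OF lc] by metis
    have g1: "norm (g r) \<le> 1" for r
      using g(2-4)[of r] y(1) by simp
    have "norm g \<le> 1"
      using g1 by (rule norm_bound)
    moreover have "1 \<le> norm g"
      using norm_bounded[of g s] g(2,5) y(1) by simp
    ultimately have "g \<in> face s y"
      using g by (auto simp: face_def)
    then have Tg: "T g t = z"
      using y(2) by (auto simp: face_def)
    have "norm ((f + N *\<^sub>R g) r) \<le> N + norm (f s) + e" for r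
    proof (cases "r \<in> U")
      case True
      have "norm ((f + N *\<^sub>R g) r) \<le> norm (f r) + N * norm (g r)"
        using norm_triangle_ineq[of "f r" "N *\<^sub>R g r"] by (simp add: N_def)
      also have "N * norm (g r) \<le> N * 1"
        using g1 by (intro mult_left_mono) (auto simp: N_def)
      finally show ?thesis
        using True by (simp add: U_def)
    next
      case False
      have "norm ((f + N *\<^sub>R g) r) = norm (f r)"
        using g(2)[of r] g(6)[OF False] by simp
      also have "\<dots> \<le> N"
        unfolding N_def by (rule norm_bounded)
      finally show ?thesis
        using that norm_ge_zero[of "f s"] by linarith
    qed
    then have le: "norm (f + N *\<^sub>R g) \<le> N + norm (f s) + e"
      by (rule norm_bound)
    have Ng: "N *\<^sub>R g \<in> C0"
      using g(1) subspace_C0 subspace_mul by blast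
    have "T (f + N *\<^sub>R g) t = w + N *\<^sub>R z"
      using T'(1)[OF f Ng] T'(2)[OF g(1), of N] Tg by (simp add: w_def)
    also have "\<dots> = (norm w + N) *\<^sub>R z"
      using wz by (metis scaleR_left_distrib)
    finally have "norm w + N = norm (T (f + N *\<^sub>R g) t)"
      using z by (simp add: N_def)
    also have "\<dots> \<le> norm (T (f + N *\<^sub>R g))"
      by (rule norm_bounded)
    also have "\<dots> = norm (f + N *\<^sub>R g)"
      using T'(3) subspace_add[OF subspace_C0 f Ng] by blast
    finally show ?thesis
      using le by linarith
  qed
  then show ?thesis
    unfolding w_def by (rule field_le_epsilon)
qed auto

text \<open>
  The base points of the image faces under \<open>T\<close> and under its inverse give mutually inverse maps of
  \<open>L\<close>. Since \<open>s \<mapsto> \<parallel>g (\<psi> s)\<parallel>\<close> is the norm of the preimage of \<open>g\<close>, it is continuous for every \<open>g\<close>; as bump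
  functions generate the topology of \<open>L\<close>, so is \<open>\<psi>\<close>.
\<close>

lemma automorphism_moves_points:
  fixes T :: "('l::t2_space \<Rightarrow>\<^sub>C 'x::real_normed_vector) \<Rightarrow> ('l \<Rightarrow>\<^sub>C 'x)"
  assumes lc: "locally_compact_space (euclidean :: 'l topology)"
    and sc: "strictly_convex_space (UNIV :: 'x set)" and y: "norm (y::'x) = 1"
    and T: "T \<in> isometric_automorphisms C0"
  obtains \<psi> where "continuous_on UNIV \<psi>" "surj \<psi>"
    "\<And>f s. f \<in> C0 \<Longrightarrow> norm (T f (\<psi> s)) = norm (f s)"
proof -
  note T' = isometric_automorphismD[OF T]
  obtain S where S: "S \<in> isometric_automorphisms C0"
      and ST: "\<And>f. f \<in> C0 \<Longrightarrow> S (T f) = f" and TS: "\<And>f. f \<in> C0 \<Longrightarrow> T (S f) = f"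
    using isometric_automorphism_inverse[OF subspace_C0 T] by metis
  have sub: "face r w \<subseteq> C0" for r and w :: 'x
    by (auto simp: face_def)
  have inverse_ST: "S ` T ` face r w = face r w" and inverse_TS: "T ` S ` face r w = face r w"
    for r and w :: 'x
    using ST TS sub[of r w] by (force simp: image_image subset_iff)+
  obtain \<psi> where \<psi>: "\<And>s y. norm y = 1 \<Longrightarrow> \<exists>z. norm z = 1 \<and> T ` face s y = face (\<psi> s) z"
    using automorphism_base_point[OF lc sc T] by metis
  obtain \<phi> where \<phi>: "\<And>t z. norm z = 1 \<Longrightarrow> \<exists>y. norm y = 1 \<and> S ` face t z = face (\<phi> t) y"
    using automorphism_base_point[OF lc sc S] by metis
  have \<phi>\<psi>: "\<phi> (\<psi> s) = s" for s
  proof -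
    obtain z where z: "norm z = 1" "T ` face s y = face (\<psi> s) z"
      using \<psi>[OF y] by blast
    obtain y' where "norm y' = 1" "S ` face (\<psi> s) z = face (\<phi> (\<psi> s)) y'"
      using \<phi>[OF z(1)] by blast
    then show ?thesis
      using face_subset_face[OF lc y, of y' s "\<phi> (\<psi> s)"] inverse_ST[of s y] z(2) by auto
  qed
  have \<psi>\<phi>: "\<psi> (\<phi> t) = t" for t
  proof -
    obtain z where z: "norm z = 1" "S ` face t y = face (\<phi> t) z"
      using \<phi>[OF y] by blast
    obtain y' where "norm y' = 1" "T ` face (\<phi> t) z = face (\<psi> (\<phi> t)) y'"
      using \<psi>[OF z(1)] by blast
    then show ?thesis
      using face_subset_face[OF lc y, of y' t "\<psi> (\<phi> t)"] inverse_TS[of t y] z(2) by auto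
  qed
  have onto: "\<exists>y. norm y = 1 \<and> T ` face s y = face (\<psi> s) z" if z: "norm z = 1" for s z
    using \<phi>[OF z, of "\<psi> s"] inverse_TS[of "\<psi> s" z] unfolding \<phi>\<psi> by metis
  have S_faces: "\<exists>z. norm z = 1 \<and> S ` face (\<psi> s) z = face s y'" if y': "norm y' = 1" for s y'
    using \<psi>[OF y', of s] inverse_ST[of s y'] by metis
  have eq: "norm (T f (\<psi> s)) = norm (f s)" if f: "f \<in> C0" for f s
  proof (rule antisym)
    show "norm (T f (\<psi> s)) \<le> norm (f s)"
      using automorphism_value_norm_le[OF lc T onto f] .
    have "T f \<in> C0"
      using f T'(4) by blast
    from automorphism_value_norm_le[OF lc S S_faces this]
    show "norm (f s) \<le> norm (T f (\<psi> s))"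
      using ST[OF f] by simp
  qed
  have "open (\<psi> -` U)" if U: "open U" for U
  proof (subst open_subopen, intro ballI)
    fix s
    assume "s \<in> \<psi> -` U"
    then obtain g :: "'l \<Rightarrow>\<^sub>C 'x" and p where
      g: "g \<in> C0" "\<And>t. g t = p t *\<^sub>R y" "p (\<psi> s) = 1" "\<And>t. t \<notin> U \<Longrightarrow> p t = 0"
      using bump_in_C0[OF lc U, of "\<psi> s"] by (metis vimageE)
    have nS: "norm (S g r) = norm (g (\<psi> r))" for r
      using eq[of "S g" r] TS[OF g(1)] g(1) isometric_automorphismD(4)[OF S] by (metis image_eqI)
    have "open {r. 0 < norm (S g r)}"
      by (intro open_Collect_less continuous_intros) auto
    moreover have "s \<in> {r. 0 < norm (S g r)}"
      unfolding nS using g(2,3) y by auto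
    moreover have "{r. 0 < norm (S g r)} \<subseteq> \<psi> -` U"
      unfolding nS using g(2,4) by fastforce
    ultimately show "\<exists>V. open V \<and> s \<in> V \<and> V \<subseteq> \<psi> -` U"
      by blast
  qed
  then have "continuous_on UNIV \<psi>"
    by (simp add: continuous_on_open_vimage)
  moreover have "surj \<psi>"
    using \<psi>\<phi> by (metis surjI)
  ultimately show ?thesis
    using that eq by blast
qed

section \<open>Connected peaks\<close>

text \<open>
  The function is the mean of a wide and a narrow bump at \<open>x\<close>. The wide bump exceeds \<open>1/2\<close> on
  a connected neighbourhood \<open>W\<close> of \<open>x\<close>, and the narrow one lives inside \<open>W\<close>: so the mean exceeds \<open>1/4\<close>
  on \<open>W\<close>, is at most \<open>1/2\<close> off \<open>W\<close>, and equals \<open>1\<close> in norm at \<open>x\<close>. Automorphisms only move \<open>W\<close>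
  continuously.
\<close>

lemma exists_connected_peak:
  fixes x :: "'l::t2_space" and y :: "'x::real_normed_vector"
  assumes lc: "locally_compact_space (euclidean :: 'l topology)"
    and x: "locally_connected_at x euclidean"
    and sc: "strictly_convex_space (UNIV :: 'x set)" and y: "norm y = 1"
  obtains h :: "'l \<Rightarrow>\<^sub>C 'x" where "h \<in> C0" "norm h = 1"
    "\<And>T. T \<in> isometric_automorphisms C0 \<Longrightarrow>
       \<exists>C. connected C \<and> {t. 1/2 < norm (T h t)} \<subseteq> C \<and> C \<subseteq> {t. 1/4 < norm (T h t)}"
proof -
  obtain f :: "'l \<Rightarrow>\<^sub>C 'x" and p where
    f: "f \<in> C0" "\<And>t. f t = p t *\<^sub>R y" "\<And>t. 0 \<le> p t" "\<And>t. p t \<le> 1" "p x = 1"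
    using bump_in_C0[OF lc open_UNIV UNIV_I] by metis
  have nf: "norm (f t) = p t" for t
    using f(2,3)[of t] y by simp
  have "open {t. 1/2 < p t}"
    unfolding nf[symmetric] by (intro open_Collect_less continuous_intros) auto
  then have "\<exists>U V. openin euclidean U \<and> (openin euclidean V \<and> connectedin euclidean V) \<and>
      x \<in> U \<and> U \<subseteq> V \<and> V \<subseteq> {t. 1/2 < p t}"
    using x f(5) unfolding locally_connected_at_def neighbourhood_base_at_def by simp
  then obtain W where W: "open W" "connected W" "x \<in> W" "W \<subseteq> {t. 1/2 < p t}"
    by (auto simp: open_openin[symmetric])
  obtain g :: "'l \<Rightarrow>\<^sub>C 'x" and q where
    g: "g \<in> C0" "\<And>t. g t = q t *\<^sub>R y" "\<And>t. 0 \<le> q t" "\<And>t. q t \<le> 1" "q x = 1"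
      "\<And>t. t \<notin> W \<Longrightarrow> q t = 0"
    using bump_in_C0[OF lc W(1,3)] by metis
  define h where "h = (1/2) *\<^sub>R (f + g)"
  have h: "h \<in> C0"
    unfolding h_def by (intro subspace_mul[OF subspace_C0] subspace_add[OF subspace_C0] f(1) g(1))
  have "h t = ((p t + q t) / 2) *\<^sub>R y" for t
    using f(2)[of t] g(2)[of t] by (simp add: h_def scaleR_left_distrib[symmetric])
  then have nh: "norm (h t) = (p t + q t) / 2" for t
    using f(3)[of t] g(3)[of t] y by simp
  have "norm (h t) \<le> 1" for t
    using f(4)[of t] g(4)[of t] nh[of t] by simp
  then have "norm h \<le> 1"
    by (rule norm_bound)
  moreover have "1 \<le> norm h"
    using norm_bounded[of h x] nh[of x] f(5) g(5) by simp
  moreover have "\<exists>C. connected C \<and> {t. 1/2 < norm (T h t)} \<subseteq> C \<and> C \<subseteq> {t. 1/4 < norm (T h t)}"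
    if T: "T \<in> isometric_automorphisms C0" for T
  proof -
    obtain \<psi> where \<psi>: "continuous_on UNIV \<psi>" "surj \<psi>" "\<And>f s. f \<in> C0 \<Longrightarrow> norm (T f (\<psi> s)) = norm (f s)"
      using automorphism_moves_points[OF lc sc y T] by metis
    have "connected (\<psi> ` W)"
      using \<psi>(1) W(2) by (meson connected_continuous_image continuous_on_subset subset_UNIV)
    moreover have "\<psi> ` W \<subseteq> {t. 1/4 < norm (T h t)}"
    proof clarify
      fix s
      assume "s \<in> W"
      then show "1/4 < norm (T h (\<psi> s))"
        using W(4) g(3)[of s] \<psi>(3)[OF h, of s] nh[of s] by auto
    qed
    moreover have "{t. 1/2 < norm (T h t)} \<subseteq> \<psi> ` W"
    proof clarify
      fix t
      assume t: "1/2 < norm (T h t)"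
      obtain s where s: "t = \<psi> s"
        using \<psi>(2) by blast
      have "s \<in> W"
        using t \<psi>(3)[OF h, of s] nh[of s] f(4)[of s] g(6)[of s] unfolding s by force
      then show "t \<in> \<psi> ` W"
        using s by blast
    qed
    ultimately show ?thesis
      by blast
  qed
  ultimately show ?thesis
    using that[of h] h by fastforce
qed

text \<open>
  The norm of the value at \<open>a\<close> plus that at \<open>b\<close> is a seminorm, equal to \<open>2\<close> for \<open>f\<close>. If each image of \<open>h\<close>
  had norm at most \<open>1/2\<close> at one of the two points, the seminorm would be at most \<open>3/2\<close> on the orbit,
  hence on its closed convex hull.
\<close>

lemma convex_transitive_exists_large_at_two_points:
  fixes f h :: "'l::topological_space \<Rightarrow>\<^sub>C 'x::real_normed_vector"
  assumes ct: "convex_transitive (C0 :: ('l \<Rightarrow>\<^sub>C 'x) set)"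
    and h: "h \<in> C0" "norm h = 1" and f: "f \<in> C0" "norm f = 1" "norm (f a) = 1" "norm (f b) = 1"
  obtains T where "T \<in> isometric_automorphisms C0" "1/2 < norm (T h a)" "1/2 < norm (T h b)"
proof (rule ccontr)
  assume "\<not> thesis"
  then have small: "norm (T h a) \<le> 1/2 \<or> norm (T h b) \<le> 1/2" if "T \<in> isometric_automorphisms C0" for T
    using that not_less \<open>\<And>T. \<lbrakk>T \<in> isometric_automorphisms C0; 1/2 < norm (T h a); 1/2 < norm (T h b)\<rbrakk> \<Longrightarrow> thesis\<close>
    by blast
  \<comment> \<open>The gap between \<open>3/2\<close> and the value \<open>2\<close> at \<open>f\<close> is twice the error \<open>1/4\<close> allowed below.\<close>
  define Q where "Q = {g :: 'l \<Rightarrow>\<^sub>C 'x. norm (g a) + norm (g b) \<le> 3/2}"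
  have "convex Q"
  proof (rule convexI)
    fix g k and u v :: real
    assume gk: "g \<in> Q" "k \<in> Q" and uv: "0 \<le> u" "0 \<le> v" "u + v = 1"
    have "norm ((u *\<^sub>R g + v *\<^sub>R k) t) \<le> u * norm (g t) + v * norm (k t)" for t
      using norm_triangle_ineq[of "u *\<^sub>R g t" "v *\<^sub>R k t"] uv by simp
    from add_mono[OF this[of a] this[of b]]
    have "norm ((u *\<^sub>R g + v *\<^sub>R k) a) + norm ((u *\<^sub>R g + v *\<^sub>R k) b) \<le>
        u * (norm (g a) + norm (g b)) + v * (norm (k a) + norm (k b))"
      by (simp add: algebra_simps)
    also have "\<dots> \<le> u * (3/2) + v * (3/2)"
      using gk uv by (intro add_mono mult_left_mono) (auto simp: Q_def)
    also have "\<dots> = 3/2"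
      using uv(3) by (simp add: field_simps)
    finally show "u *\<^sub>R g + v *\<^sub>R k \<in> Q"
      by (simp add: Q_def)
  qed
  moreover have "isometry_orbit C0 h \<subseteq> Q"
  proof
    fix g
    assume "g \<in> isometry_orbit C0 h"
    then obtain T where T: "T \<in> isometric_automorphisms C0" "g = T h"
      by (auto simp: isometry_orbit_def)
    have "norm g = 1"
      using T h isometric_automorphismD(3) by metis
    then show "g \<in> Q"
      using small[OF T(1)] norm_bounded[of g a] norm_bounded[of g b] by (auto simp: Q_def T(2))
  qed
  ultimately have hull: "convex hull (isometry_orbit C0 h) \<subseteq> Q"
    by (intro hull_minimal)
  have "f \<in> closure (convex hull (isometry_orbit C0 h))"
    using ct h f unfolding convex_transitive_def by auto
  then obtain g where g: "g \<in> Q" "dist g f < 1/4"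
    using hull unfolding closure_approachable by (metis subsetD zero_less_divide_1_iff zero_less_numeral)
  have "norm (f t) - 1/4 < norm (g t)" for t
    using dist_fun_lt_imp_dist_val_lt[OF g(2), of t] norm_triangle_sub[of "f t" "g t"]
    by (simp add: dist_norm norm_minus_commute)
  from this[of a] this[of b] show False
    using g(1) f(3,4) by (simp add: Q_def)
qed

theorem theorem2p4:
  fixes x :: "'l::t2_space"
  assumes "locally_compact_space (euclidean :: 'l topology)"
    and "locally_connected_at x euclidean"
    and "(UNIV :: 'x::banach set) \<noteq> {0}"
    and "strictly_convex_space (UNIV :: 'x set)"
  shows "(almost_transitive (C0 :: ('l \<Rightarrow>\<^sub>C 'x) set) \<longrightarrow> is_singleton (UNIV :: 'l set)) \<and>
         (convex_transitive (C0 :: ('l \<Rightarrow>\<^sub>C 'x) set) \<longrightarrow> connected (UNIV :: 'l set))"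
proof -
  obtain v :: 'x where "v \<noteq> 0"
    using assms(3) by blast
  then obtain y :: 'x where y: "norm y = 1"
    by (metis norm_sgn)
  obtain h :: "'l \<Rightarrow>\<^sub>C 'x" where h: "h \<in> C0" "norm h = 1" and
    peak: "\<And>T. T \<in> isometric_automorphisms C0 \<Longrightarrow>
       \<exists>C. connected C \<and> {t. 1/2 < norm (T h t)} \<subseteq> C \<and> C \<subseteq> {t. 1/4 < norm (T h t)}"
    using exists_connected_peak[OF assms(1,2,4) y] by metis
  show ?thesis
  proof (intro conjI impI)
    assume at: "almost_transitive (C0 :: ('l \<Rightarrow>\<^sub>C 'x) set)"
    have "a = x" for a
    proof (rule ccontr)
      assume "a \<noteq> x"
      then obtain U V where UV: "open U" "open V" "a \<in> U" "x \<in> V" "U \<inter> V = {}"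
        by (meson hausdorff)
      obtain f :: "'l \<Rightarrow>\<^sub>C 'x" where f: "f \<in> C0" "norm f = 1" "f a = y" "f x = y"
          "\<And>r. f r \<noteq> 0 \<Longrightarrow> r \<in> U \<union> V"
        using two_bumps_in_C0[OF assms(1) UV y y] by metis
      have "f \<in> closure (isometry_orbit C0 h)"
        using at h f unfolding almost_transitive_def by auto
      then obtain T where T: "T \<in> isometric_automorphisms C0" "dist (T h) f < 1/4"
        unfolding closure_approachable isometry_orbit_def
        by (smt (verit, best) mem_Collect_eq zero_less_divide_1_iff)
      have close: "norm (f t) - 1/4 < norm (T h t)" "norm (T h t) - 1/4 < norm (f t)" for t
        using dist_fun_lt_imp_dist_val_lt[OF T(2), of t] norm_triangle_sub[of "f t" "T h t"]
          norm_triangle_sub[of "T h t" "f t"]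
        by (simp_all add: dist_norm norm_minus_commute)
      obtain C where C: "connected C" "{t. 1/2 < norm (T h t)} \<subseteq> C" "C \<subseteq> {t. 1/4 < norm (T h t)}"
        using peak[OF T(1)] by blast
      have "a \<in> C" "x \<in> C"
        using C(2) close(1)[of a] close(1)[of x] f(3,4) y by auto
      moreover have "C \<subseteq> U \<union> V"
      proof
        fix t
        assume "t \<in> C"
        then have "0 < norm (f t)"
          using C(3) close(2)[of t] by force
        then show "t \<in> U \<union> V"
          using f(5) by simp
      qed
      ultimately show False
        using connectedD[OF C(1) UV(1,2)] UV(3-5) by blast
    qed
    then have "(UNIV :: 'l set) = {x}"
      by blast
    then show "is_singleton (UNIV :: 'l set)"
      unfolding is_singleton_def by blast
  next
    assume ct: "convex_transitive (C0 :: ('l \<Rightarrow>\<^sub>C 'x) set)"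
    show "connected (UNIV :: 'l set)"
    proof (rule connectedI)
      fix A B :: "'l set"
      assume AB: "open A" "open B" "A \<inter> UNIV \<noteq> {}" "B \<inter> UNIV \<noteq> {}" "A \<inter> B \<inter> UNIV = {}" "UNIV \<subseteq> A \<union> B"
      then obtain a b where ab: "a \<in> A" "b \<in> B"
        by blast
      have disj: "A \<inter> B = {}"
        using AB(5) by simp
      obtain f :: "'l \<Rightarrow>\<^sub>C 'x" where f: "f \<in> C0" "norm f = 1" "f a = y" "f b = y"
        using two_bumps_in_C0[OF assms(1) AB(1,2) ab disj y y] by metis
      have "norm (f a) = 1" "norm (f b) = 1"
        using f y by auto
      then obtain T where T: "T \<in> isometric_automorphisms C0" "1/2 < norm (T h a)" "1/2 < norm (T h b)"
        using convex_transitive_exists_large_at_two_points[OF ct h f(1,2)] by metis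
      obtain C where "connected C" "{t. 1/2 < norm (T h t)} \<subseteq> C"
        using peak[OF T(1)] by blast
      moreover from this have "a \<in> C" "b \<in> C"
        using T(2,3) by auto
      ultimately show False
        using connectedD[of C A B] AB(1,2,6) ab disj by blast
    qed
  qed
qed

end
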